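(* Let $\mathcal{N}$ be a set of $N\ge 2$ elements (players), and let $M$ be an integer satisfying $2\le M<N$. A partition $\mathcal{P}=\{\mathcal{S}_1,\dots,\mathcal{S}_P\}$ of $\mathcal{N}$ (a coalition structure) satisfying $2\le|\mathcal{S}_m|\le M$ for all $m$ exists if and only if there exists an integer $P\ge 1$ such that $$\left\lceil\frac{N}{M}\right\rceil\le P\le\left\lfloor\frac{N}{2}\right\rfloor.$$
   Context: A coalition structure on $\mathcal{N}$ is a partition of $\mathcal{N}$ into nonempty, pairwise disjoint subsets whose union is $\mathcal{N}$. *)

theory Defs
  imports Complex_Main "HOL-Library.Disjoint_Sets"
begin

end

theory Submission imports Defs begin

text \<open>A sum of k integers taken from the interval from 2 to M can take every value from 2k to
  kM, and no other. Hence a set of N elements splits into exactly k blocks of admissible size iff 2k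
  \<le> N \<le> kM. Dividing by 2 and M and rounding, this says that k lies between the ceiling of
  N/M and the floor of N/2, so the integer P of the theorem is the number of blocks.
  \<open>partition_on_card_between\<close> gives necessity by summing block sizes;
  \<open>ex_partition_on_card_between\<close> gives sufficiency by splitting off one block at a
  time. Both use natural numbers and a general lower bound \<open>a\<close>.\<close>

text \<open>Induction on \<open>k\<close>: remove one block whose size \<open>s\<close> keeps the
  remainder within the same two bounds for one block fewer. Positivity of \<open>a\<close> makes the
  removed block nonempty, hence different from the other blocks, so the count rises by exactly
  one.\<close>

lemma ex_partition_on_card_between:
  fixes a m k :: nat
  assumes "finite A" and "0 < a" and "k * a \<le> card A" and "card A \<le> k * m"
  shows "\<exists>\<P>. partition_on A \<P> \<and> card \<P> = k \<and> (\<forall>S\<in>\<P>. a \<le> card S \<and> card S \<le> m)"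
  using assms
proof (induction k arbitrary: A)
  case 0
  then have "partition_on A {}"
    by (simp add: partition_on_empty)
  then show ?case by (intro exI[of _ "{}"]) simp
next
  case (Suc k)
  \<comment> \<open>Comparing the two bounds on \<open>card A\<close> yields
    \<open>a \<le> m\<close>, which is available only because the number of blocks is positive
    here.\<close>
  have "Suc k * a \<le> Suc k * m"
    using Suc.prems by linarith
  then have "a \<le> m" by (simp only: mult_le_cancel1)
  then have kam: "k * a \<le> k * m" by simp
  \<comment> \<open>The smallest first block that leaves at most \<open>k * m\<close> elements for the others.\<close>
  define s where "s = max a (card A - k * m)"
  \<comment> \<open>If \<open>s = a\<close>, the remainder has at least \<open>k * a\<close>
    elements by the lower bound on \<open>card A\<close>. Otherwise it has exactly
    \<open>k * m\<close>, and \<open>s \<le> m\<close> by the upper bound. Truncated subtraction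
    gives 0 when \<open>card A \<le> k * m\<close>, so the maximum is then \<open>a\<close>.\<close>
  have s: "a \<le> s" "s \<le> m" "s \<le> card A" "k * a \<le> card A - s" "card A - s \<le> k * m"
    using Suc.prems(3,4) \<open>a \<le> m\<close> kam unfolding s_def mult_Suc by linarith+
  obtain B where B: "B \<subseteq> A" "card B = s" "finite B"
    using obtain_subset_with_card_n[OF s(3)] by metis
  have "card (A - B) = card A - s"
    using B by (simp add: card_Diff_subset)
  then obtain \<P> where P: "partition_on (A - B) \<P>" "card \<P> = k"
      "\<forall>S\<in>\<P>. a \<le> card S \<and> card S \<le> m"
    using Suc.IH[of "A - B"] Suc.prems s by auto
  have "B \<noteq> {}" using B s \<open>0 < a\<close> by auto
  have "B \<notin> \<P>"
    using partition_onD1[OF P(1)] \<open>B \<noteq> {}\<close> by blast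
  have "finite \<P>"
    using P(1) Suc.prems(1) finite_elements by blast
  have "disjnt B (\<Union>\<P>)"
    using partition_onD1[OF P(1)] by (auto simp: disjnt_iff)
  then have "partition_on A (insert B \<P>)"
    using P(1) B \<open>B \<noteq> {}\<close> by (simp add: partition_on_insert)
  moreover have "card (insert B \<P>) = Suc k"
    using \<open>finite \<P>\<close> \<open>B \<notin> \<P>\<close> P(2) by simp
  ultimately show ?case
    using P(3) B s by blast
qed

text \<open>The block sizes add up to \<open>card A\<close>, so it suffices to bound each
  summand.\<close>

lemma partition_on_card_between:
  fixes a m :: nat
  assumes "finite A" and "partition_on A \<P>" and "\<forall>S\<in>\<P>. a \<le> card S \<and> card S \<le> m"
  shows "card \<P> * a \<le> card A" and "card A \<le> card \<P> * m"
proof -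
  have "card A = (\<Sum>S\<in>\<P>. card S)"
    using assms(1,2) card_Union_disjoint[of \<P>]
    by (metis finite_UnionD finite_subset Sup_upper partition_onD1 partition_onD2)
  then show "card \<P> * a \<le> card A" and "card A \<le> card \<P> * m"
    using assms(3) sum_bounded_below[of \<P> a card] sum_bounded_above[of \<P> card m] by auto
qed

theorem lemma1:
  fixes \<N> :: "'a set" and N :: nat and M :: int
  assumes "finite \<N>" and "card \<N> = N" and "N \<ge> 2"
    and "2 \<le> M" and "M < int N"
  shows "(\<exists>\<P>. partition_on \<N> \<P> \<and> (\<forall>S\<in>\<P>. 2 \<le> int (card S) \<and> int (card S) \<le> M))
     \<longleftrightarrow> (\<exists>P::int. P \<ge> 1 \<and> \<lceil>real N / real_of_int M\<rceil> \<le> P \<and> P \<le> \<lfloor>real N / 2\<rfloor>)"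
    (is "?L \<longleftrightarrow> ?R")
proof -
  obtain m where M: "M = int m"
    using \<open>2 \<le> M\<close> by (metis nonneg_int_cases order_trans zero_le_numeral)
  have m: "0 < m" using assms M by simp
  \<comment> \<open>A ceiling is at most an integer iff its argument is, and dually for floors. So
    for integral \<open>k\<close> the rounding disappears and the denominators can be
    cleared.\<close>
  have bounds: "\<lceil>real N / real_of_int M\<rceil> \<le> int k \<and> int k \<le> \<lfloor>real N / 2\<rfloor>
      \<longleftrightarrow> N \<le> k * m \<and> k * 2 \<le> N" for k
  proof -
    have "\<lceil>real N / real_of_int M\<rceil> \<le> int k \<longleftrightarrow> real N \<le> real (k * m)"
      using m by (simp add: M ceiling_le_iff pos_divide_le_eq)
    moreover have "int k \<le> \<lfloor>real N / 2\<rfloor> \<longleftrightarrow> real (k * 2) \<le> real N"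
      by (simp add: le_floor_iff pos_le_divide_eq)
    ultimately show ?thesis by (simp only: of_nat_le_iff)
  qed
  have sizes: "2 \<le> int (card S) \<and> int (card S) \<le> M \<longleftrightarrow> 2 \<le> card S \<and> card S \<le> m" for S :: "'a set"
    using M by auto
  show ?thesis
  proof
    assume ?L
    then obtain \<P> where "partition_on \<N> \<P>" "\<forall>S\<in>\<P>. 2 \<le> card S \<and> card S \<le> m"
      unfolding sizes by blast
    then have le: "N \<le> card \<P> * m" "card \<P> * 2 \<le> N"
      using partition_on_card_between[of \<N> \<P> 2 m] assms by auto
    \<comment> \<open>Without blocks, \<open>N \<le> card \<P> * m\<close> would force
      \<open>N = 0\<close>.\<close>
    then have "card \<P> \<noteq> 0" using \<open>N \<ge> 2\<close> by (intro notI) simp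
    then show ?R
      using le bounds[of "card \<P>"] by (intro exI[of _ "int (card \<P>)"]) auto
  next
    assume ?R
    then obtain P :: int where "P \<ge> 1" "\<lceil>real N / real_of_int M\<rceil> \<le> P" "P \<le> \<lfloor>real N / 2\<rfloor>"
      by blast
    \<comment> \<open>Since \<open>P \<ge> 1\<close>, passing to \<open>nat P\<close> loses nothing;
      it is the number of blocks to construct.\<close>
    then have "N \<le> nat P * m" "nat P * 2 \<le> N"
      using bounds[of "nat P"] by auto
    then show ?L
      unfolding sizes using ex_partition_on_card_between[of \<N> 2 "nat P" m] assms by auto
  qed
qed

end
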